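(* For every integer $n\ge 3$, the Tits representation $\Theta : L_n \longrightarrow \mathrm{GL}_{n-1}(\mathbb{C})$ of the triplet group $L_n$ is irreducible, i.e. the only linear subspaces of $\mathbb{C}^{n-1}$ invariant under $\Theta(L_n)$ are $\{0\}$ and $\mathbb{C}^{n-1}$.
   Context: The triplet group $L_n$ is the group generated by $\ell_1,\ldots,\ell_{n-1}$ subject to the relations $\ell_i^2=1$ for $1\le i\le n-1$ and $\ell_i\ell_{i+1}\ell_i=\ell_{i+1}\ell_i\ell_{i+1}$ for $1\le i\le n-2$ (no commutation relations are imposed). For $n\ge 3$, the Tits representation is the homomorphism $\Theta:L_n\to \mathrm{GL}_{n-1}(\mathbb{C})$, $\Theta(\ell_i)=\Lambda_i$, where $\Lambda_i$ is the $(n-1)\times(n-1)$ matrix that agrees with the identity matrix outside row $i$, and whose row $i$ has entries: $-1$ in column $i$; $1$ in every column $j$ with $|i-j|=1$; $2$ in every column $j$ with $|i-j|\ge 2$ ($1\le j\le n-1$). Matrices act on column vectors. *)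

theory Defs
  imports "Jordan_Normal_Form.VS_Connect"
begin

text \<open>
  A word over the generating set \<open>S\<close> is a list of letters \<open>(s, b)\<close>, which stands for \<open>s\<close>
  if \<open>b\<close> is true and for the formal inverse of \<open>s\<close> otherwise. A relation \<open>(l, r)\<close> in \<open>R\<close>
  stands for the equation \<open>l = r\<close>. The group presented by \<open>S\<close> and \<open>R\<close> is the quotient of the
  words by the congruence generated by free cancellation and by \<open>R\<close>.
\<close>

type_synonym 'g word = "('g \<times> bool) list"

abbreviation words :: "'g set \<Rightarrow> 'g word set" where
  "words S \<equiv> lists (S \<times> UNIV)"

inductive word_eq :: "'g set \<Rightarrow> ('g word \<times> 'g word) set \<Rightarrow> 'g word \<Rightarrow> 'g word \<Rightarrow> bool"
  for S :: "'g set" and R :: "('g word \<times> 'g word) set" where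
  refl: "w \<in> words S \<Longrightarrow> word_eq S R w w"
| sym: "word_eq S R v w \<Longrightarrow> word_eq S R w v"
| trans: "word_eq S R u v \<Longrightarrow> word_eq S R v w \<Longrightarrow> word_eq S R u w"
| cancel: "u \<in> words S \<Longrightarrow> v \<in> words S \<Longrightarrow> s \<in> S \<Longrightarrow>
    word_eq S R (u @ [(s, b), (s, \<not> b)] @ v) (u @ v)"
| relation: "u \<in> words S \<Longrightarrow> v \<in> words S \<Longrightarrow> (l, r) \<in> R \<Longrightarrow> l \<in> words S \<Longrightarrow> r \<in> words S \<Longrightarrow>
    word_eq S R (u @ l @ v) (u @ r @ v)"

definition word_rel :: "'g set \<Rightarrow> ('g word \<times> 'g word) set \<Rightarrow> ('g word \<times> 'g word) set" where
  "word_rel S R = {(v, w). word_eq S R v w}"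

definition presented_group :: "'g set \<Rightarrow> ('g word \<times> 'g word) set \<Rightarrow> 'g word set monoid" where
  "presented_group S R =
    \<lparr> carrier = words S // word_rel S R,
      mult = (\<lambda>A B. \<Union>a\<in>A. \<Union>b\<in>B. word_rel S R `` {a @ b}),
      one = word_rel S R `` {[]} \<rparr>"

definition presented_gen :: "'g set \<Rightarrow> ('g word \<times> 'g word) set \<Rightarrow> 'g \<Rightarrow> 'g word set" where
  "presented_gen S R s = word_rel S R `` {[(s, True)]}"

fun eval_word :: "('a, 'b) monoid_scheme \<Rightarrow> ('g \<Rightarrow> 'a) \<Rightarrow> 'g word \<Rightarrow> 'a" where
  "eval_word H f [] = \<one>\<^bsub>H\<^esub>"
| "eval_word H f ((s, b) # w) = (if b then f s else inv\<^bsub>H\<^esub> (f s)) \<otimes>\<^bsub>H\<^esub> eval_word H f w"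

text \<open>
  If \<open>f\<close> satisfies the relations in \<open>H\<close>, then all words in a class have the same value, and this
  is the homomorphism to \<open>H\<close> that sends each generator \<open>s\<close> to \<open>f s\<close>; otherwise it is meaningless.
\<close>

definition presented_lift :: "('a, 'b) monoid_scheme \<Rightarrow> ('g \<Rightarrow> 'a) \<Rightarrow> 'g word set \<Rightarrow> 'a" where
  "presented_lift H f A = the_elem (eval_word H f ` A)"

lemma word_eq_words: "word_eq S R v w \<Longrightarrow> v \<in> words S \<and> w \<in> words S"
  by (induction rule: word_eq.induct) auto

lemma word_eq_context:
  "word_eq S R v w \<Longrightarrow> p \<in> words S \<Longrightarrow> q \<in> words S \<Longrightarrow> word_eq S R (p @ v @ q) (p @ w @ q)"
proof (induction rule: word_eq.induct)
  case (refl w)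
  then show ?case by (auto intro!: word_eq.refl)
next
  case (sym v w)
  then show ?case by (auto intro: word_eq.sym)
next
  case (trans u v w)
  then show ?case by (blast intro: word_eq.trans)
next
  case (cancel u v s b)
  then show ?case using word_eq.cancel[of "p @ u" S "v @ q" s R b] by auto
next
  case (relation u v l r)
  then show ?case using word_eq.relation[of "p @ u" S "v @ q" l r R] by auto
qed

lemma word_eq_append:
  assumes "word_eq S R v v'" "word_eq S R w w'"
  shows "word_eq S R (v @ w) (v' @ w')"
proof -
  have "word_eq S R (v @ w) (v' @ w)"
    using word_eq_context[OF assms(1), of "[]" w] word_eq_words[OF assms(2)] by auto
  moreover have "word_eq S R (v' @ w) (v' @ w')"
    using word_eq_context[OF assms(2), of v' "[]"] word_eq_words[OF assms(1)] by auto
  ultimately show ?thesis by (rule word_eq.trans)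
qed

lemma word_rel_iff: "(v, w) \<in> word_rel S R \<longleftrightarrow> word_eq S R v w"
  by (simp add: word_rel_def)

lemma equiv_word_rel: "equiv (words S) (word_rel S R)"
proof (rule equivI)
  show "word_rel S R \<subseteq> words S \<times> words S"
    unfolding word_rel_def using word_eq_words by blast
  show "refl_on (words S) (word_rel S R)"
    by (rule refl_onI) (simp only: word_rel_iff word_eq.refl)
  show "sym (word_rel S R)"
    by (rule symI) (simp only: word_rel_iff word_eq.sym)
  show "trans (word_rel S R)"
    by (rule transI) (unfold word_rel_iff, rule word_eq.trans)
qed

lemma word_class_eq: "word_eq S R v w \<Longrightarrow> word_rel S R `` {v} = word_rel S R `` {w}"
  by (rule equiv_class_eq[OF equiv_word_rel]) (simp only: word_rel_iff)

lemma UN2_constant: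
  assumes "x \<in> X" "y \<in> Y" "\<And>a b. a \<in> X \<Longrightarrow> b \<in> Y \<Longrightarrow> F a b = C"
  shows "(\<Union>a\<in>X. \<Union>b\<in>Y. F a b) = C"
  using assms by (auto; blast)

lemma presented_mult_class:
  assumes "v \<in> words S" "w \<in> words S"
  shows "(word_rel S R `` {v}) \<otimes>\<^bsub>presented_group S R\<^esub> (word_rel S R `` {w}) = word_rel S R `` {v @ w}"
proof -
  have "word_rel S R `` {a @ b} = word_rel S R `` {v @ w}"
    if "a \<in> word_rel S R `` {v}" "b \<in> word_rel S R `` {w}" for a b
  proof -
    from that have "word_eq S R v a" "word_eq S R w b" by (simp_all only: Image_singleton_iff word_rel_iff)
    then have "word_eq S R (v @ w) (a @ b)" by (rule word_eq_append)
    then show ?thesis by (rule word_class_eq[symmetric])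
  qed
  note const = this
  have "v \<in> word_rel S R `` {v}" "w \<in> word_rel S R `` {w}"
    using assms by (simp_all only: Image_singleton_iff word_rel_iff word_eq.refl)
  then have "(\<Union>a\<in>word_rel S R `` {v}. \<Union>b\<in>word_rel S R `` {w}. word_rel S R `` {a @ b}) =
      word_rel S R `` {v @ w}"
    by (rule UN2_constant) (rule const)
  then show ?thesis by (simp only: presented_group_def monoid.simps)
qed

lemma presented_carrierE:
  assumes "A \<in> carrier (presented_group S R)"
  obtains w where "w \<in> words S" "A = word_rel S R `` {w}"
proof -
  have "A \<in> words S // word_rel S R" using assms by (simp add: presented_group_def)
  then show ?thesis using that by (rule quotientE)
qed

lemma presented_carrierI: "w \<in> words S \<Longrightarrow> word_rel S R `` {w} \<in> carrier (presented_group S R)"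
  by (auto simp: presented_group_def intro: quotientI)

lemma presented_one: "\<one>\<^bsub>presented_group S R\<^esub> = word_rel S R `` {[]}"
  by (simp add: presented_group_def)

lemma word_inverse_exists:
  "w \<in> words S \<Longrightarrow> \<exists>v\<in>words S. word_eq S R (v @ w) []"
proof (induction w)
  case Nil
  show ?case by (rule bexI[of _ "[]"]) (auto intro: word_eq.refl)
next
  case (Cons a w)
  obtain s b where a: "a = (s, b)" by force
  from Cons obtain v where v: "v \<in> words S" "word_eq S R (v @ w) []" by auto
  have "word_eq S R (v @ [(s, \<not> b), (s, \<not> \<not> b)] @ w) (v @ w)"
    using v Cons.prems a by (intro word_eq.cancel) auto
  then have "word_eq S R ((v @ [(s, \<not> b)]) @ a # w) []"
    using v(2) a by (simp add: word_eq.trans)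
  moreover have "v @ [(s, \<not> b)] \<in> words S" using v Cons.prems a by auto
  ultimately show ?case by blast
qed

lemma group_presented_group: "group (presented_group S R)"
proof (rule groupI)
  fix A B C
  assume ABC: "A \<in> carrier (presented_group S R)" "B \<in> carrier (presented_group S R)"
    "C \<in> carrier (presented_group S R)"
  obtain a where "a \<in> words S" "A = word_rel S R `` {a}" using ABC(1) by (rule presented_carrierE)
  moreover obtain b where "b \<in> words S" "B = word_rel S R `` {b}" using ABC(2) by (rule presented_carrierE)
  moreover obtain c where "c \<in> words S" "C = word_rel S R `` {c}" using ABC(3) by (rule presented_carrierE)
  ultimately show "A \<otimes>\<^bsub>presented_group S R\<^esub> B \<otimes>\<^bsub>presented_group S R\<^esub> C =
    A \<otimes>\<^bsub>presented_group S R\<^esub> (B \<otimes>\<^bsub>presented_group S R\<^esub> C)"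
    by (simp add: presented_mult_class)
next
  fix A B
  assume AB: "A \<in> carrier (presented_group S R)" "B \<in> carrier (presented_group S R)"
  obtain a where "a \<in> words S" "A = word_rel S R `` {a}" using AB(1) by (rule presented_carrierE)
  moreover obtain b where "b \<in> words S" "B = word_rel S R `` {b}" using AB(2) by (rule presented_carrierE)
  ultimately show "A \<otimes>\<^bsub>presented_group S R\<^esub> B \<in> carrier (presented_group S R)"
    by (simp add: presented_mult_class presented_carrierI)
next
  show "\<one>\<^bsub>presented_group S R\<^esub> \<in> carrier (presented_group S R)"
    by (simp add: presented_one presented_carrierI)
next
  fix A
  assume "A \<in> carrier (presented_group S R)"
  then obtain a where a: "a \<in> words S" "A = word_rel S R `` {a}"
    by (rule presented_carrierE)
  then show "\<one>\<^bsub>presented_group S R\<^esub> \<otimes>\<^bsub>presented_group S R\<^esub> A = A"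
    by (simp add: presented_one presented_mult_class)
  from word_inverse_exists[OF a(1)] obtain v where v: "v \<in> words S" "word_eq S R (v @ a) []"
    by blast
  from v(2) have "word_rel S R `` {v @ a} = word_rel S R `` {[]}"
    by (rule word_class_eq)
  with a v show "\<exists>B\<in>carrier (presented_group S R). B \<otimes>\<^bsub>presented_group S R\<^esub> A = \<one>\<^bsub>presented_group S R\<^esub>"
    by (intro bexI[of _ "word_rel S R `` {v}"])
      (simp_all add: presented_one presented_mult_class presented_carrierI)
qed

lemma eval_word_closed:
  assumes "group H" "f \<in> S \<rightarrow> carrier H" "w \<in> words S"
  shows "eval_word H f w \<in> carrier H"
proof -
  interpret group H by fact
  show ?thesis using assms(3) by (induction w) (use assms(2) in \<open>auto simp: Pi_iff\<close>)
qed

lemma eval_word_append: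
  assumes "group H" "f \<in> S \<rightarrow> carrier H" "v \<in> words S" "w \<in> words S"
  shows "eval_word H f (v @ w) = eval_word H f v \<otimes>\<^bsub>H\<^esub> eval_word H f w"
proof -
  interpret group H by fact
  note closed = eval_word_closed[OF assms(1,2)]
  show ?thesis using assms(3)
  proof (induction v)
    case Nil
    then show ?case using closed assms(4) by auto
  next
    case (Cons a v)
    then show ?case using closed assms(2,4) by (cases a) (auto simp: m_assoc Pi_iff)
  qed
qed

lemma eval_word_cong:
  assumes "group H" "f \<in> S \<rightarrow> carrier H"
    and rels: "\<And>l r. (l, r) \<in> R \<Longrightarrow> eval_word H f l = eval_word H f r"
    and "word_eq S R v w"
  shows "eval_word H f v = eval_word H f w"
proof -
  interpret group H by fact
  note app = eval_word_append[OF assms(1,2)]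
  note closed = eval_word_closed[OF assms(1,2)]
  show ?thesis using assms(4)
  proof (induction rule: word_eq.induct)
    case (cancel u v s b)
    have s: "f s \<in> carrier H" using cancel assms(2) by auto
    have "eval_word H f ([(s, b), (s, \<not> b)] @ v) = eval_word H f v"
      using s closed[OF cancel(2)] by (auto simp: m_assoc[symmetric])
    with cancel show ?case by (subst (1 2) app) auto
  next
    case (relation u v l r)
    then show ?case using rels[OF relation(3)] by (simp add: app)
  qed simp_all
qed

lemma presented_lift_class:
  assumes "group H" "f \<in> S \<rightarrow> carrier H"
    and "\<And>l r. (l, r) \<in> R \<Longrightarrow> eval_word H f l = eval_word H f r"
    and "w \<in> words S"
  shows "presented_lift H f (word_rel S R `` {w}) = eval_word H f w"
proof -
  have "eval_word H f v = eval_word H f w" if "v \<in> word_rel S R `` {w}" for v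
  proof -
    from that have "word_eq S R w v" by (simp add: word_rel_def)
    then have "eval_word H f w = eval_word H f v"
      by (rule eval_word_cong[OF assms(1,2), rotated]) (rule assms(3))
    then show ?thesis by (rule HOL.sym)
  qed
  moreover have "w \<in> word_rel S R `` {w}"
    using word_eq.refl[OF assms(4)] by (simp add: word_rel_def)
  ultimately have "eval_word H f ` (word_rel S R `` {w}) = {eval_word H f w}" by blast
  then show ?thesis by (simp add: presented_lift_def)
qed

lemma presented_lift_hom:
  assumes "group H" "f \<in> S \<rightarrow> carrier H"
    and "\<And>l r. (l, r) \<in> R \<Longrightarrow> eval_word H f l = eval_word H f r"
  shows "presented_lift H f \<in> hom (presented_group S R) H"
proof (rule homI)
  note cls = presented_lift_class[OF assms]
  fix A assume "A \<in> carrier (presented_group S R)"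
  then obtain a where a: "a \<in> words S" "A = word_rel S R `` {a}"
    by (rule presented_carrierE)
  then show "presented_lift H f A \<in> carrier H"
    using cls eval_word_closed[OF assms(1,2)] by simp
  fix B assume "B \<in> carrier (presented_group S R)"
  then obtain b where b: "b \<in> words S" "B = word_rel S R `` {b}"
    by (rule presented_carrierE)
  show "presented_lift H f (A \<otimes>\<^bsub>presented_group S R\<^esub> B) = presented_lift H f A \<otimes>\<^bsub>H\<^esub> presented_lift H f B"
    using a b cls eval_word_append[OF assms(1,2)] by (simp add: presented_mult_class)
qed

lemma presented_lift_gen:
  assumes "group H" "f \<in> S \<rightarrow> carrier H"
    and "\<And>l r. (l, r) \<in> R \<Longrightarrow> eval_word H f l = eval_word H f r"
    and "s \<in> S"
  shows "presented_lift H f (presented_gen S R s) = f s"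
proof -
  interpret group H by fact
  have "f s \<in> carrier H" using assms(2,4) by auto
  with assms(4) show ?thesis
    unfolding presented_gen_def by (subst presented_lift_class[OF assms(1-3)]) auto
qed

definition GL :: "nat \<Rightarrow> complex mat monoid" where
  "GL m = units_of (ring_mat TYPE(complex) m ())"

definition invariant_subspace ::
  "('a, 'b) monoid_scheme \<Rightarrow> nat \<Rightarrow> ('a \<Rightarrow> complex mat) \<Rightarrow> complex vec set \<Rightarrow> bool" where
  "invariant_subspace G m \<rho> W \<longleftrightarrow>
    subspace class_ring W (module_vec TYPE(complex) m) \<and>
    (\<forall>g\<in>carrier G. \<forall>w\<in>W. \<rho> g *\<^sub>v w \<in> W)"

definition irreducible_rep :: "('a, 'b) monoid_scheme \<Rightarrow> nat \<Rightarrow> ('a \<Rightarrow> complex mat) \<Rightarrow> bool" where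
  "irreducible_rep G m \<rho> \<longleftrightarrow>
    \<rho> \<in> hom G (GL m) \<and>
    (\<forall>W. invariant_subspace G m \<rho> W \<longrightarrow> W = {0\<^sub>v m} \<or> W = carrier_vec m)"

definition triplet_rels :: "nat \<Rightarrow> (nat word \<times> nat word) set" where
  "triplet_rels n =
    {([(i, True), (i, True)], []) | i. 1 \<le> i \<and> i \<le> n - 1} \<union>
    {([(i, True), (i + 1, True), (i, True)], [(i + 1, True), (i, True), (i + 1, True)]) | i.
       1 \<le> i \<and> i \<le> n - 2}"

definition triplet_group :: "nat \<Rightarrow> nat word set monoid" where
  "triplet_group n = presented_group {1..n - 1} (triplet_rels n)"

definition triplet_gen :: "nat \<Rightarrow> nat \<Rightarrow> nat word set" where
  "triplet_gen n i = presented_gen {1..n - 1} (triplet_rels n) i"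

text \<open>
  Generators are numbered from 1, whereas \<^const>\<open>mat\<close> numbers rows and columns from 0; hence row
  \<open>i\<close> of the usual numbering is row \<open>r\<close> with \<open>r + 1 = i\<close>.
\<close>

definition tits_matrix :: "nat \<Rightarrow> nat \<Rightarrow> complex mat" where
  "tits_matrix n i = mat (n - 1) (n - 1) (\<lambda>(r, c).
     if r + 1 = i then
       (if c + 1 = i then - 1
        else if \<bar>int i - int (c + 1)\<bar> = 1 then 1
        else 2)
     else (if r = c then 1 else 0))"

definition tits_rep :: "nat \<Rightarrow> nat word set \<Rightarrow> complex mat" where
  "tits_rep n = presented_lift (GL (n - 1)) (tits_matrix n)"

text \<open>
  \<open>tits_matrix n i\<close> is the identity minus the matrix whose row \<open>i\<close> is \<open>tits_form i\<close> and whose other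
  rows vanish.
\<close>

definition tits_form :: "nat \<Rightarrow> nat \<Rightarrow> complex" where
  "tits_form i j = (if i = j then 2 else if \<bar>int i - int j\<bar> = 1 then - 1 else - 2)"

lemma tits_matrix_carrier: "tits_matrix n i \<in> carrier_mat (n - 1) (n - 1)"
  by (simp add: tits_matrix_def)

lemma tits_matrix_mult:
  assumes "A \<in> carrier_mat (n - 1) (n - 1)" "1 \<le> i" "i \<le> n - 1" "r < n - 1" "c < n - 1"
  shows "(tits_matrix n i * A) $$ (r, c) = A $$ (r, c) -
    (if r + 1 = i then \<Sum>k<n - 1. tits_form i (k + 1) * A $$ (k, c) else 0)"
proof -
  have entry: "tits_matrix n i $$ (r, k) = (if k = r then 1 else 0) -
      (if r + 1 = i then tits_form i (k + 1) else 0)" if "k < n - 1" for k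
    using that assms by (auto simp: tits_matrix_def tits_form_def)
  have "(tits_matrix n i * A) $$ (r, c) = (\<Sum>k<n - 1. tits_matrix n i $$ (r, k) * A $$ (k, c))"
    using assms tits_matrix_carrier[of n i]
    by (auto simp: scalar_prod_def lessThan_atLeast0 intro!: sum.cong)
  also have "\<dots> = (\<Sum>k<n - 1. (if k = r then A $$ (k, c) else 0) -
      (if r + 1 = i then tits_form i (k + 1) * A $$ (k, c) else 0))"
    by (rule sum.cong) (auto simp: entry algebra_simps)
  also have "\<dots> = A $$ (r, c) -
      (if r + 1 = i then \<Sum>k<n - 1. tits_form i (k + 1) * A $$ (k, c) else 0)"
    using assms by (simp add: sum_subtractf sum.delta)
  finally show ?thesis .
qed

lemma sum_delta_form:
  fixes g :: "nat \<Rightarrow> complex"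
  assumes "1 \<le> i" "i \<le> m"
  shows "(\<Sum>k<m. g (k + 1) * (if k + 1 = i then x else 0)) = g i * x"
proof -
  have "(\<Sum>k<m. g (k + 1) * (if k + 1 = i then x else 0)) = (\<Sum>k<m. if k = i - 1 then g i * x else 0)"
    using assms by (intro sum.cong) auto
  then show ?thesis using assms by simp
qed

lemma tits_matrix_entry:
  assumes "1 \<le> i" "r < n - 1" "c < n - 1"
  shows "tits_matrix n i $$ (r, c) =
    (if r + 1 = c + 1 then 1 else 0) - (if r + 1 = i then tits_form i (c + 1) else 0)"
  using assms by (auto simp: tits_matrix_def tits_form_def)

lemma tits_matrix_mult2_entry:
  assumes "1 \<le> i" "i \<le> n - 1" "1 \<le> j" "j \<le> n - 1" "r < n - 1" "c < n - 1"
  shows "(tits_matrix n i * tits_matrix n j) $$ (r, c) =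
    (if r + 1 = c + 1 then 1 else 0) - (if r + 1 = j then tits_form j (c + 1) else 0) -
    (if r + 1 = i then tits_form i (c + 1) - tits_form i j * tits_form j (c + 1) else 0)"
proof -
  have "(\<Sum>k<n - 1. tits_form i (k + 1) * tits_matrix n j $$ (k, c)) =
      (\<Sum>k<n - 1. tits_form i (k + 1) * (if k + 1 = c + 1 then 1 else 0) -
        tits_form i (k + 1) * (if k + 1 = j then tits_form j (c + 1) else 0))"
    using assms by (intro sum.cong) (auto simp: tits_matrix_entry algebra_simps)
  also have "\<dots> = tits_form i (c + 1) * 1 - tits_form i j * tits_form j (c + 1)"
    unfolding sum_subtractf
    using assms by (subst (1 2) sum_delta_form) auto
  finally show ?thesis
    using assms by (simp add: tits_matrix_mult[OF tits_matrix_carrier] tits_matrix_entry)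
qed

lemma tits_matrix_mult3_entry:
  assumes "1 \<le> i" "i \<le> n - 1" "1 \<le> j" "j \<le> n - 1" "r < n - 1" "c < n - 1"
  shows "(tits_matrix n i * (tits_matrix n j * tits_matrix n i)) $$ (r, c) =
    (tits_matrix n j * tits_matrix n i) $$ (r, c) -
    (if r + 1 = i then tits_form i (c + 1) - tits_form i i * tits_form i (c + 1) -
      tits_form i j * (tits_form j (c + 1) - tits_form j i * tits_form i (c + 1)) else 0)"
proof -
  have "(\<Sum>k<n - 1. tits_form i (k + 1) * (tits_matrix n j * tits_matrix n i) $$ (k, c)) =
      (\<Sum>k<n - 1. tits_form i (k + 1) * (if k + 1 = c + 1 then 1 else 0) -
        tits_form i (k + 1) * (if k + 1 = i then tits_form i (c + 1) else 0) -
        tits_form i (k + 1) * (if k + 1 = j then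
          tits_form j (c + 1) - tits_form j i * tits_form i (c + 1) else 0))"
    using assms by (intro sum.cong) (auto simp: tits_matrix_mult2_entry algebra_simps)
  also have "\<dots> = tits_form i (c + 1) * 1 - tits_form i i * tits_form i (c + 1) -
      tits_form i j * (tits_form j (c + 1) - tits_form j i * tits_form i (c + 1))"
    unfolding sum_subtractf
    using assms by (subst (1 2 3) sum_delta_form) auto
  finally show ?thesis
    by (simp only: tits_matrix_mult[OF mult_carrier_mat[OF tits_matrix_carrier tits_matrix_carrier] assms(1,2,5,6)] mult_1_right)
qed

lemma tits_matrix_square:
  assumes "1 \<le> i" "i \<le> n - 1"
  shows "tits_matrix n i * tits_matrix n i = 1\<^sub>m (n - 1)"
proof (rule eq_matI)
  fix r c
  assume "r < dim_row (1\<^sub>m (n - 1) :: complex mat)" "c < dim_col (1\<^sub>m (n - 1) :: complex mat)"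
  then have rc: "r < n - 1" "c < n - 1" by auto
  have "tits_form i i = 2" by (simp add: tits_form_def)
  then show "(tits_matrix n i * tits_matrix n i) $$ (r, c) = 1\<^sub>m (n - 1) $$ (r, c)"
    unfolding tits_matrix_mult2_entry[OF assms assms rc] using rc by auto
qed (simp_all add: tits_matrix_def)

lemma tits_matrix_braid:
  assumes "1 \<le> i" "i + 1 \<le> n - 1"
  shows "tits_matrix n i * (tits_matrix n (i + 1) * tits_matrix n i) =
    tits_matrix n (i + 1) * (tits_matrix n i * tits_matrix n (i + 1))"
proof (rule eq_matI)
  fix r c
  assume "r < dim_row (tits_matrix n (i + 1) * (tits_matrix n i * tits_matrix n (i + 1)))"
    "c < dim_col (tits_matrix n (i + 1) * (tits_matrix n i * tits_matrix n (i + 1)))"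
  then have rc: "r < n - 1" "c < n - 1" by (auto simp: tits_matrix_def)
  have ij: "1 \<le> i" "i \<le> n - 1" "1 \<le> i + 1" "i + 1 \<le> n - 1" using assms by auto
  have vals: "tits_form i i = 2" "tits_form (i + 1) (i + 1) = 2" "tits_form i (i + 1) = - 1"
    "tits_form (i + 1) i = - 1" by (auto simp: tits_form_def)
  show "(tits_matrix n i * (tits_matrix n (i + 1) * tits_matrix n i)) $$ (r, c) =
    (tits_matrix n (i + 1) * (tits_matrix n i * tits_matrix n (i + 1))) $$ (r, c)"
    unfolding tits_matrix_mult3_entry[OF ij rc] tits_matrix_mult3_entry[OF ij(3,4,1,2) rc]
      tits_matrix_mult2_entry[OF ij rc] tits_matrix_mult2_entry[OF ij(3,4,1,2) rc] vals
    by auto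
qed (simp_all add: tits_matrix_def)

lemma group_GL: "group (GL m)"
proof -
  interpret ring "ring_mat TYPE(complex) m ()" by (rule ring_mat)
  show ?thesis unfolding GL_def by (rule units_group)
qed

lemma GL_simps:
  "mult (GL m) = (*)" "one (GL m) = 1\<^sub>m m"
  by (simp_all add: GL_def units_of_def ring_mat_simps)

lemma tits_matrix_GL:
  assumes "1 \<le> i" "i \<le> n - 1"
  shows "tits_matrix n i \<in> carrier (GL (n - 1))"
  using tits_matrix_square[OF assms] tits_matrix_carrier[of n i]
  by (auto simp: GL_def units_of_def Units_def ring_mat_simps)

lemma tits_matrix_rels:
  assumes "(l, r) \<in> triplet_rels n"
  shows "eval_word (GL (n - 1)) (tits_matrix n) l = eval_word (GL (n - 1)) (tits_matrix n) r"
proof -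
  have unit: "tits_matrix n i * 1\<^sub>m (n - 1) = tits_matrix n i" for i
    using tits_matrix_carrier by (rule right_mult_one_mat)
  consider i where "1 \<le> i" "i \<le> n - 1" "l = [(i, True), (i, True)]" "r = []"
    | i where "1 \<le> i" "i + 1 \<le> n - 1" "l = [(i, True), (i + 1, True), (i, True)]"
      "r = [(i + 1, True), (i, True), (i + 1, True)]"
    using assms unfolding triplet_rels_def by fastforce
  then show ?thesis
  proof cases
    case 1
    then show ?thesis by (simp add: GL_simps unit tits_matrix_square del: One_nat_def)
  next
    case 2
    then show ?thesis using tits_matrix_braid[OF 2(1,2)] by (simp add: GL_simps unit del: One_nat_def)
  qed
qed

lemma group_triplet_group: "group (triplet_group n)"
  by (simp add: triplet_group_def group_presented_group)

lemma tits_rep_hom: "tits_rep n \<in> hom (triplet_group n) (GL (n - 1))"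
  unfolding tits_rep_def triplet_group_def
  by (rule presented_lift_hom) (auto simp: group_GL tits_matrix_rels tits_matrix_GL simp del: One_nat_def)

lemma tits_rep_gen:
  assumes "1 \<le> i" "i \<le> n - 1"
  shows "tits_rep n (triplet_gen n i) = tits_matrix n i"
  unfolding tits_rep_def triplet_gen_def
  by (rule presented_lift_gen) (use assms in \<open>auto simp: group_GL tits_matrix_rels tits_matrix_GL simp del: One_nat_def\<close>)

end

theory Submission
  imports Defs
begin

text \<open>
  Write \<open>m = n - 1\<close> and let \<open>B\<close> be the symmetric matrix with entries \<^const>\<open>tits_form\<close>. Generator
  \<open>i\<close> acts by the reflection that takes \<open>w\<close> to \<open>w - (B w)\<^sub>i e\<^sub>i\<close>. Let \<open>W\<close> be an invariant subspace.

  If \<open>(B w)\<^sub>i \<noteq> 0\<close> for some \<open>w\<close> in \<open>W\<close> and some \<open>i\<close>, then \<open>e\<^sub>i\<close> is a multiple of the difference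
  of \<open>w\<close> and its image, hence \<open>e\<^sub>i\<close> lies in \<open>W\<close>. No entry of \<open>B\<close> is zero: generators that
  are not adjacent contribute \<open>-2\<close> instead of the 0 that a commutation relation would give. The
  same argument with \<open>e\<^sub>i\<close> for \<open>w\<close> puts every \<open>e\<^sub>j\<close> into \<open>W\<close>, and \<open>W\<close> is the whole space
  (\<open>invariant_subspace_tits_rep_unit_vec\<close>).

  Otherwise \<open>W\<close> lies in the kernel of \<open>B\<close>, and it remains to see that \<open>B\<close> is nondegenerate
  (\<open>tits_form_nondegenerate\<close>). Here \<open>B = 4 I + A - 2 J\<close>, where \<open>A\<close> is the adjacency matrix of a
  path and all entries of \<open>J\<close> are 1, so \<open>B w = 0\<close> says that \<open>4 w\<^sub>i + w\<^bsub>i-1\<^esub> + w\<^bsub>i+1\<^esub> = t\<close> for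
  all \<open>i\<close>, where \<open>t\<close> is twice the sum of the \<open>w\<^sub>i\<close>. The diagonal 4 dominates the two neighbours,
  hence the \<open>\<bar>w\<^sub>i\<bar>\<close> are at most \<open>\<bar>t\<bar>/2\<close> (\<open>path_equation_bound\<close>), and the outermost ones even at
  most \<open>3\<bar>t\<bar>/8\<close>. But the sum of all equations is \<open>w\<^sub>1 + w\<^sub>m = (3 - m) t\<close>, which for \<open>m \<ge> 4\<close> is
  too large unless \<open>t = 0\<close>; for \<open>m \<le> 3\<close> the equations give \<open>t = 0\<close> directly
  (\<open>path_equation_sum_zero\<close>). With \<open>t = 0\<close> the bound yields \<open>w = 0\<close>.
\<close>

section \<open>Nondegeneracy of the form\<close>

lemma tits_form_nonzero: "tits_form i j \<noteq> 0"
  by (simp add: tits_form_def)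

text \<open>
  This is the decomposition \<open>4 I + A - 2 J\<close>. The zero values at \<open>0\<close> and \<open>m + 1\<close> spare the
  two ends of the path a separate treatment.
\<close>

lemma tits_form_apply:
  fixes y :: "nat \<Rightarrow> complex"
  assumes "y 0 = 0" "y (Suc m) = 0" "1 \<le> i" "i \<le> m"
  shows "(\<Sum>j=1..m. tits_form i j * y j) = 4 * y i + y (i - 1) + y (i + 1) - 2 * (\<Sum>j=1..m. y j)"
proof -
  have "(\<Sum>j=1..m. tits_form i j * y j) = (\<Sum>j=0..Suc m. tits_form i j * y j)"
    using assms(1,2) by (simp add: sum.atLeast_Suc_atMost)
  also have "\<dots> = (\<Sum>j=0..Suc m. (if j = i then 4 * y j else 0) + (if j = i - 1 then y j else 0)
      + (if j = i + 1 then y j else 0) - 2 * y j)"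
    using assms(3) by (intro sum.cong) (auto simp: tits_form_def)
  also have "\<dots> = 4 * y i + y (i - 1) + y (i + 1) - 2 * (\<Sum>j=0..Suc m. y j)"
    using assms(4) by (simp add: sum.distrib sum_subtractf sum_distrib_left del: sum.cl_ivl_Suc)
  also have "(\<Sum>j=0..Suc m. y j) = (\<Sum>j=1..m. y j)"
    using assms(1,2) by (simp add: sum.atLeast_Suc_atMost)
  finally show ?thesis .
qed

text \<open>
  At an index where the norm is maximal, the two neighbours cancel at most half of the
  term \<open>4 * y i\<close>.
\<close>

lemma path_equation_bound:
  fixes y :: "nat \<Rightarrow> complex"
  assumes "y 0 = 0" "y (Suc m) = 0"
    and eq: "\<And>i. 1 \<le> i \<Longrightarrow> i \<le> m \<Longrightarrow> 4 * y i + y (i - 1) + y (i + 1) = t"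
    and "i \<le> Suc m"
  shows "norm (y i) \<le> norm t / 2"
proof -
  define M where "M = Max ((\<lambda>j. norm (y j)) ` {..Suc m})"
  have le: "norm (y j) \<le> M" if "j \<le> Suc m" for j
    unfolding M_def using that by (intro Max_ge) auto
  have "M \<in> (\<lambda>j. norm (y j)) ` {..Suc m}"
    unfolding M_def by (intro Max_in) auto
  then obtain k where k: "k \<le> Suc m" "M = norm (y k)" by auto
  have "M \<le> norm t / 2"
  proof (cases "k = 0 \<or> k = Suc m")
    case True
    then show ?thesis using k assms(1,2) by auto
  next
    case False
    then have "4 * y k = t - y (k - 1) - y (k + 1)"
      using eq[of k] k(1) by (simp add: algebra_simps)
    then have "4 * norm (y k) = norm (t - y (k - 1) - y (k + 1))"
      by (metis norm_mult norm_numeral)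
    also have "\<dots> \<le> norm t + norm (y (k - 1)) + norm (y (k + 1))"
      using norm_triangle_ineq4[of "t - y (k - 1)" "y (k + 1)"] norm_triangle_ineq4[of t "y (k - 1)"]
      by linarith
    also have "\<dots> \<le> norm t + M + M"
      using False k(1) by (intro add_mono le) auto
    finally show ?thesis using k(2) by simp
  qed
  then show ?thesis using le[OF assms(4)] by simp
qed

text \<open>
  Summing all equations counts every \<open>y i\<close> six times, except that each end of the path lacks
  one neighbour. This fixes \<open>y 1 + y m\<close>, and for \<open>m \<ge> 4\<close> the end values are too small for it.
\<close>

lemma path_equation_sum_zero:
  fixes y :: "nat \<Rightarrow> complex"
  assumes ends: "y 0 = 0" "y (Suc m) = 0"
    and eq: "\<And>i. 1 \<le> i \<Longrightarrow> i \<le> m \<Longrightarrow> 4 * y i + y (i - 1) + y (i + 1) = t"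
    and t: "t = 2 * (\<Sum>j=1..m. y j)"
  shows "t = 0"
proof -
  let ?S = "\<Sum>j=1..m. y j"
  have left: "(\<Sum>j=1..m. y (j - 1)) = ?S - y m"
  proof -
    have "(\<Sum>j=1..m. y (j - 1)) = (\<Sum>j<m. y j)"
      by (rule sum.reindex_bij_witness[of _ Suc "\<lambda>j. j - 1"]) auto
    also have "\<dots> = (\<Sum>j\<le>m. y j) - y m" by (simp flip: lessThan_Suc_atMost)
    also have "(\<Sum>j\<le>m. y j) = ?S" using ends by (simp add: atMost_atLeast0 sum.atLeast_Suc_atMost)
    finally show ?thesis .
  qed
  have right: "(\<Sum>j=1..m. y (j + 1)) = ?S - y 1"
  proof -
    have "(\<Sum>j=1..m. y (j + 1)) = (\<Sum>j=Suc 1..Suc m. y j)"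
      unfolding sum.shift_bounds_cl_Suc_ivl by simp
    also have "\<dots> = (\<Sum>j=1..Suc m. y j) - y 1" by (simp add: sum.atLeast_Suc_atMost del: sum.cl_ivl_Suc)
    finally show ?thesis using ends by simp
  qed
  have "(\<Sum>i=1..m. 4 * y i + y (i - 1) + y (i + 1)) = (\<Sum>i=1..m. t)"
    by (rule sum.cong) (use eq in auto)
  then have "4 * ?S + (?S - y m) + (?S - y 1) = of_nat m * t"
    unfolding sum.distrib left right by (simp add: sum_distrib_left)
  then have total: "y 1 + y m = (3 - of_nat m) * t"
    using t by (simp add: algebra_simps)
  consider "m = 0" | "m = 1" | "m = 2" | "m = 3" | "m \<ge> 4" by linarith
  then show ?thesis
  proof cases
    case 1
    then show ?thesis using t by simp
  next
    case 2
    then show ?thesis using total t by simp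
  next
    case 3
    have "?S = y 1 + y 2" using 3 by (simp add: numeral_2_eq_2)
    moreover have "y 1 + y 2 = t" using total 3 by simp
    ultimately have "t = 2 * t" using t by metis
    then show ?thesis by simp
  next
    case 4
    have "?S = y 1 + y 2 + y 3" using 4 by (simp add: numeral_eq_Suc)
    moreover have "4 * y 2 + y 1 + y 3 = t" using eq[of 2] 4 by (simp add: numeral_eq_Suc)
    moreover have "y 3 = - y 1" using total 4 by (simp add: add_eq_0_iff)
    ultimately have "?S = y 2" "4 * y 2 = t" by simp_all
    then have "4 * y 2 = 2 * y 2" using t by metis
    then show ?thesis using \<open>4 * y 2 = t\<close> by simp
  next
    case 5
    have bound: "norm (y i) \<le> norm t / 2" if "i \<le> Suc m" for i
      using path_equation_bound[OF ends eq that] .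
    (* An end of the path has only one neighbour, which sharpens the general bound. *)
    have "4 * y 1 = t - y 2" using eq[of 1] ends 5 by (simp add: numeral_2_eq_2 algebra_simps)
    then have "4 * norm (y 1) = norm (t - y 2)" by (metis norm_mult norm_numeral)
    then have y1: "4 * norm (y 1) \<le> 3 / 2 * norm t"
      using norm_triangle_ineq4[of t "y 2"] bound[of 2] 5 by simp
    have "4 * y m = t - y (m - 1)" using eq[of m] ends 5 by (simp add: algebra_simps)
    then have "4 * norm (y m) = norm (t - y (m - 1))" by (metis norm_mult norm_numeral)
    moreover have "norm (y (m - 1)) \<le> norm t / 2" by (rule bound) simp
    ultimately have ym: "4 * norm (y m) \<le> 3 / 2 * norm t"
      using norm_triangle_ineq4[of t "y (m - 1)"] by simp
    have "norm (3 - of_nat m :: complex) = real m - 3"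
    proof -
      have "(3 - of_nat m :: complex) = of_real (3 - real m)" by simp
      then show ?thesis using 5 by (simp only: norm_of_real)
    qed
    then have "(real m - 3) * norm t = norm (y 1 + y m)" by (simp only: total norm_mult)
    moreover have "norm t \<le> (real m - 3) * norm t"
      using 5 mult_right_mono[of 1 "real m - 3" "norm t"] by simp
    ultimately have "norm t \<le> 3 / 4 * norm t"
      using norm_triangle_ineq[of "y 1" "y m"] y1 ym by linarith
    then show ?thesis by simp
  qed
qed

lemma tits_form_nondegenerate:
  fixes x :: "nat \<Rightarrow> complex"
  assumes ker: "\<And>i. 1 \<le> i \<Longrightarrow> i \<le> m \<Longrightarrow> (\<Sum>j=1..m. tits_form i j * x j) = 0"
    and "1 \<le> k" "k \<le> m"
  shows "x k = 0"
proof -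
  define y where "y j = (if 1 \<le> j \<and> j \<le> m then x j else 0)" for j
  define t where "t = 2 * (\<Sum>j=1..m. y j)"
  have ends: "y 0 = 0" "y (Suc m) = 0" by (simp_all add: y_def)
  have eq: "4 * y i + y (i - 1) + y (i + 1) = t" if "1 \<le> i" "i \<le> m" for i
  proof -
    have "(\<Sum>j=1..m. tits_form i j * y j) = (\<Sum>j=1..m. tits_form i j * x j)"
      by (rule sum.cong) (auto simp: y_def)
    then show ?thesis
      using tits_form_apply[of y m i] ends that ker[OF that] by (simp add: t_def)
  qed
  have "t = 0" by (rule path_equation_sum_zero[OF ends eq t_def])
  then have "y k = 0" using path_equation_bound[OF ends eq, of k] assms(3) by simp
  then show ?thesis using assms(2,3) by (simp add: y_def)
qed

section \<open>Invariant subspaces\<close>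

text \<open>
  Only row \<open>i\<close> differs from the identity. \<^const>\<open>tits_form\<close> counts from 1 and vectors from 0,
  hence the shifts by one.
\<close>

lemma tits_matrix_reflection:
  assumes "1 \<le> i" "i \<le> n - 1" "w \<in> carrier_vec (n - 1)"
  shows "tits_matrix n i *\<^sub>v w =
    w - (\<Sum>j=1..n - 1. tits_form i j * w $ (j - 1)) \<cdot>\<^sub>v unit_vec (n - 1) (i - 1)"
proof (rule eq_vecI)
  let ?s = "\<Sum>j=1..n - 1. tits_form i j * w $ (j - 1)"
  fix r
  assume "r < dim_vec (w - ?s \<cdot>\<^sub>v unit_vec (n - 1) (i - 1))"
  then have r: "r < n - 1" by simp
  have "(tits_matrix n i *\<^sub>v w) $ r = (\<Sum>k<n - 1. tits_matrix n i $$ (r, k) * w $ k)"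
    using r assms(3) tits_matrix_carrier[of n i]
    by (auto simp: scalar_prod_def lessThan_atLeast0 intro!: sum.cong)
  also have "\<dots> = (\<Sum>k<n - 1. (if k = r then w $ k else 0) -
      (if r + 1 = i then tits_form i (k + 1) * w $ k else 0))"
    using r assms(1) by (intro sum.cong) (auto simp: tits_matrix_entry algebra_simps)
  also have "\<dots> = w $ r - (if r + 1 = i then \<Sum>k<n - 1. tits_form i (k + 1) * w $ k else 0)"
    using r by (simp add: sum_subtractf)
  also have "(\<Sum>k<n - 1. tits_form i (k + 1) * w $ k) = ?s"
    by (rule sum.reindex_bij_witness[of _ "\<lambda>j. j - 1" Suc]) auto
  finally show "(tits_matrix n i *\<^sub>v w) $ r = (w - ?s \<cdot>\<^sub>v unit_vec (n - 1) (i - 1)) $ r"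
    using r assms by auto
qed (use assms tits_matrix_carrier[of n i] in auto)

lemma subspace_module_vecD:
  assumes "subspace class_ring W (module_vec TYPE(complex) m)"
  shows "W \<subseteq> carrier_vec m" "0\<^sub>v m \<in> W"
    and "\<And>v w. v \<in> W \<Longrightarrow> w \<in> W \<Longrightarrow> v + w \<in> W"
    and "\<And>a v. v \<in> W \<Longrightarrow> a \<cdot>\<^sub>v v \<in> W"
proof -
  interpret submodule class_ring W "module_vec TYPE(complex) m"
    using assms by (simp add: subspace_def)
  show "W \<subseteq> carrier_vec m" using subset by (simp add: module_vec_simps)
  show "0\<^sub>v m \<in> W" using zero_closed by (simp add: module_vec_simps)
  show "v + w \<in> W" if "v \<in> W" "w \<in> W" for v w
    using m_closed[OF that] by (simp add: module_vec_simps)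
  show "a \<cdot>\<^sub>v v \<in> W" if "v \<in> W" for a v
    using smult_closed[of a v] that by (simp add: module_vec_simps class_ring_simps)
qed

lemma subspace_unit_vecs:
  assumes sub: "subspace class_ring W (module_vec TYPE(complex) m)"
    and unit: "\<And>i. i < m \<Longrightarrow> unit_vec m i \<in> W"
  shows "W = carrier_vec m"
proof
  note W = subspace_module_vecD[OF sub]
  show "W \<subseteq> carrier_vec m" by (rule W(1))
  show "carrier_vec m \<subseteq> W"
  proof
    fix v :: "complex vec" assume v: "v \<in> carrier_vec m"
    have "vec m (\<lambda>i. if i < k then v $ i else 0) \<in> W" if "k \<le> m" for k
      using that
    proof (induction k)
      case 0
      have "vec m (\<lambda>i. if i < 0 then v $ i else 0) = 0\<^sub>v m" by auto
      then show ?case using W(2) by simp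
    next
      case (Suc k)
      have "vec m (\<lambda>i. if i < Suc k then v $ i else 0) =
          vec m (\<lambda>i. if i < k then v $ i else 0) + v $ k \<cdot>\<^sub>v unit_vec m k"
        using Suc.prems by (intro eq_vecI) (auto simp: less_Suc_eq)
      then show ?case using Suc W(3,4) unit[of k] by simp
    qed
    moreover have "vec m (\<lambda>i. if i < m then v $ i else 0) = v" using v by auto
    ultimately show "v \<in> W" by (metis order_refl)
  qed
qed

text \<open>
  The reflection moves \<open>w\<close> by a nonzero multiple of the unit vector, and both \<open>w\<close> and its image
  lie in \<open>W\<close>.
\<close>

lemma invariant_subspace_tits_rep_unit_vec:
  assumes inv: "invariant_subspace (triplet_group n) (n - 1) (tits_rep n) W"
    and i: "1 \<le> i" "i \<le> n - 1" and w: "w \<in> W"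
    and nonzero: "(\<Sum>j=1..n - 1. tits_form i j * w $ (j - 1)) \<noteq> 0"
  shows "unit_vec (n - 1) (i - 1) \<in> W"
proof -
  let ?s = "\<Sum>j=1..n - 1. tits_form i j * w $ (j - 1)"
  let ?e = "unit_vec (n - 1) (i - 1) :: complex vec"
  have sub: "subspace class_ring W (module_vec TYPE(complex) (n - 1))"
    using inv by (simp add: invariant_subspace_def)
  note W = subspace_module_vecD[OF sub]
  have wc: "w \<in> carrier_vec (n - 1)" using W(1) w by auto
  have "triplet_gen n i \<in> carrier (triplet_group n)"
    unfolding triplet_gen_def triplet_group_def presented_gen_def
    using i by (intro presented_carrierI) auto
  then have "tits_rep n (triplet_gen n i) *\<^sub>v w \<in> W"
    using inv w by (simp add: invariant_subspace_def)
  then have "w - ?s \<cdot>\<^sub>v ?e \<in> W"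
    by (simp only: tits_rep_gen[OF i] tits_matrix_reflection[OF i wc])
  then have "(1 / ?s) \<cdot>\<^sub>v (w + (- 1) \<cdot>\<^sub>v (w - ?s \<cdot>\<^sub>v ?e)) \<in> W"
    using W(3,4) w by blast
  also have "(1 / ?s) \<cdot>\<^sub>v (w + (- 1) \<cdot>\<^sub>v (w - ?s \<cdot>\<^sub>v ?e)) = ?e"
    using wc nonzero by (intro eq_vecI) auto
  finally show ?thesis .
qed

theorem theorem12:
  fixes n :: nat
  assumes "n \<ge> 3"
  shows "irreducible_rep (triplet_group n) (n - 1) (tits_rep n)"
  unfolding irreducible_rep_def
proof (intro conjI allI impI)
  show "tits_rep n \<in> hom (triplet_group n) (GL (n - 1))" by (rule tits_rep_hom)
next
  fix W
  assume inv: "invariant_subspace (triplet_group n) (n - 1) (tits_rep n) W"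
  then have sub: "subspace class_ring W (module_vec TYPE(complex) (n - 1))"
    by (simp add: invariant_subspace_def)
  note W = subspace_module_vecD[OF sub]
  note unit = invariant_subspace_tits_rep_unit_vec[OF inv]
  show "W = {0\<^sub>v (n - 1)} \<or> W = carrier_vec (n - 1)"
  proof (cases "\<exists>w\<in>W. \<exists>i. 1 \<le> i \<and> i \<le> n - 1 \<and> (\<Sum>j=1..n - 1. tits_form i j * w $ (j - 1)) \<noteq> 0")
    case True
    then obtain i where i: "1 \<le> i" "i \<le> n - 1" and ei: "unit_vec (n - 1) (i - 1) \<in> W"
      using unit by blast
    have "unit_vec (n - 1) k \<in> W" if "k < n - 1" for k
    proof -
      have "(\<Sum>j=1..n - 1. tits_form (k + 1) j * unit_vec (n - 1) (i - 1) $ (j - 1)) =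
          (\<Sum>j=1..n - 1. if j = i then tits_form (k + 1) j else 0)"
        using i by (intro sum.cong) (auto simp: unit_vec_def split: if_splits)
      also have "\<dots> = tits_form (k + 1) i" using i by simp
      finally show ?thesis
        using unit[of "k + 1", OF _ _ ei] that tits_form_nonzero[of "k + 1" i] by simp
    qed
    then show ?thesis using subspace_unit_vecs[OF sub] by blast
  next
    case False
    have "w = 0\<^sub>v (n - 1)" if w: "w \<in> W" for w
    proof (rule eq_vecI)
      fix r assume "r < dim_vec (0\<^sub>v (n - 1) :: complex vec)"
      then have r: "r < n - 1" by simp
      have "w $ (r + 1 - 1) = 0"
        by (rule tits_form_nondegenerate[where x = "\<lambda>j. w $ (j - 1)" and m = "n - 1"])
          (use False w r in auto)
      then show "w $ r = 0\<^sub>v (n - 1) $ r" using r by simp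
    qed (use W(1) w in auto)
    then show ?thesis using W(2) by blast
  qed
qed

end
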